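(* For every real $\varepsilon>0$ and every integer $k>0$, $\mathbf{M}_\iota^\varepsilon\cong_{\mathrm{T}}\mathbf{R}_\iota^k$ for $\iota\in\{\forall,\exists\}$. Consequently, $\mathfrak{b}(\mathbf{M}_\forall^\varepsilon)=\mathfrak{b}$ and $\mathfrak{d}(\mathbf{M}_\forall^\varepsilon)=\mathfrak{d}$, and $\mathfrak{b}(\mathbf{M}_\exists^\varepsilon)=\mathfrak{d}$ and $\mathfrak{d}(\mathbf{M}_\exists^\varepsilon)=\mathfrak{b}$.
   Context: A relational system $\mathbf{R}=\langle X,Y,\sqsubset\rangle$ consists of two non-empty sets $X,Y$ and a relation $\sqsubset$ between elements of $X$ and elements of $Y$. A set $F\subseteq X$ is $\mathbf{R}$-bounded if $\exists y\in Y\,\forall x\in F\; x\sqsubset y$, and $\mathbf{R}$-unbounded otherwise; $E\subseteq Y$ is $\mathbf{R}$-dominating if $\forall x\in X\,\exists y\in E\; x\sqsubset y$. Put $\mathfrak{b}(\mathbf{R})=\min\{|F|: F\subseteq X \text{ is } \mathbf{R}\text{-unbounded}\}$ and $\mathfrak{d}(\mathbf{R})=\min\{|D|: D\subseteq Y\text{ is }\mathbf{R}\text{-dominating}\}$. For $\mathbf{R}=\langle X,Y,\sqsubset\rangle$ and $\mathbf{R}'=\langle X',Y',\sqsubset'\rangle$, $\mathbf{R}\preceq_{\mathrm{T}}\mathbf{R}'$ means there are functions $\Psi_-\colon X\to X'$, $\Psi_+\colon Y'\to Y$ such that for all $x\in X$, $y'\in Y'$: $\Psi_-(x)\sqsubset'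 y'$ implies $x\sqsubset\Psi_+(y')$. $\mathbf{R}\cong_{\mathrm{T}}\mathbf{R}'$ means $\mathbf{R}\preceq_{\mathrm{T}}\mathbf{R}'$ and $\mathbf{R}'\preceq_{\mathrm{T}}\mathbf{R}$. $\omega^{\uparrow\omega}$ is the set of strictly increasing functions $\omega\to\omega$; $[\omega]^\omega$ is the set of infinite subsets of $\omega$; $\forall^\infty n$ means "for all but finitely many $n\in\omega$", $\exists^\infty n$ means "for infinitely many $n\in\omega$". $\mathfrak{b}$ and $\mathfrak{d}$ denote $\mathfrak{b}(\mathbf{D})$ and $\mathfrak{d}(\mathbf{D})$ for $\mathbf{D}=\langle\omega^{\uparrow\omega},\omega^{\uparrow\omega},\le^*\rangle$, where $x\le^* y$ means $\forall^\infty n\; x(n)\le y(n)$. For $\iota\in\{\forall,\exists\}$, $\mathbf{R}_\iota^k=\langle\omega^{\uparrow\omega},[\omega]^\omega,\sqsubset_\iota^k\rangle$, where $f\sqsubset_\iota^k X$ iff $\iota^\infty n\; |[f(n),f(n+1))\cap X|\le k$. $\mathcal{P}_\infty(\mathbb{R}_{\ge 0})$ is the family of all (Lebesgue measurable) subsets of $\mathbb{R}_{\ge0}$ of infinite Lebesgue measure; $\mu$ is Lebesgue measure. For $\iota\in\{\forall,\exists\}$, $\mathbf{M}_\iota^\varepsilon=\langle\omega^{\uparrow\omega},\mathcal{P}_\infty(\mathbb{R}_{\ge0}),\vartriangleleft_\iota^\varepsilon\rangle$, where $f\vartriangleleft_\iota^\varepsilon Y$ iff $\iota^\infty n\;\mu([f(n),f(n+1))\cap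 Y)\le\varepsilon$, with $[f(n),f(n+1))$ here a real interval. *)

theory Defs
  imports "HOL-Analysis.Analysis"
begin

unbundle cardinal_syntax

record ('a, 'b) relational_system =
  challenges :: "'a set"
  responses :: "'b set"
  met_by :: "'a \<Rightarrow> 'b \<Rightarrow> bool"

definition is_relational_system :: "('a, 'b) relational_system \<Rightarrow> bool" where
  "is_relational_system R \<longleftrightarrow> challenges R \<noteq> {} \<and> responses R \<noteq> {}"

definition R_bounded :: "('a, 'b) relational_system \<Rightarrow> 'a set \<Rightarrow> bool" where
  "R_bounded R F \<longleftrightarrow> F \<subseteq> challenges R \<and> (\<exists>y\<in>responses R. \<forall>x\<in>F. met_by R x y)"

definition R_unbounded :: "('a, 'b) relational_system \<Rightarrow> 'a set \<Rightarrow> bool" where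
  "R_unbounded R F \<longleftrightarrow> F \<subseteq> challenges R \<and> \<not> R_bounded R F"

definition R_dominating :: "('a, 'b) relational_system \<Rightarrow> 'b set \<Rightarrow> bool" where
  "R_dominating R E \<longleftrightarrow> E \<subseteq> responses R \<and> (\<forall>x\<in>challenges R. \<exists>y\<in>E. met_by R x y)"

text \<open>
  The least cardinality of a set in a family. Cardinals are the cardinal orders of the
  library, so the value is determined up to \<open>=o\<close>, which also compares cardinals over
  different types. For the empty family the value is unspecified; the lemmas at the end of this
  theory show that the cardinals considered here are minima of nonempty families.
\<close>

definition min_card :: "'a set set \<Rightarrow> 'a rel" where
  "min_card S = |SOME A. A \<in> S \<and> (\<forall>B\<in>S. |A| \<le>o |B| )|"

definition bounding_number :: "('a, 'b) relational_system \<Rightarrow> 'a rel" where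
  "bounding_number R = min_card {F. R_unbounded R F}"

definition dominating_number :: "('a, 'b) relational_system \<Rightarrow> 'b rel" where
  "dominating_number R = min_card {E. R_dominating R E}"

definition tukey_le ::
    "('a, 'b) relational_system \<Rightarrow> ('c, 'd) relational_system \<Rightarrow> bool" (infix "\<preceq>\<^sub>T" 50) where
  "R \<preceq>\<^sub>T R' \<longleftrightarrow>
     (\<exists>\<Psi>m \<in> challenges R \<rightarrow> challenges R'. \<exists>\<Psi>p \<in> responses R' \<rightarrow> responses R.
        \<forall>x\<in>challenges R. \<forall>y'\<in>responses R'. met_by R' (\<Psi>m x) y' \<longrightarrow> met_by R x (\<Psi>p y'))"

definition tukey_equiv ::
    "('a, 'b) relational_system \<Rightarrow> ('c, 'd) relational_system \<Rightarrow> bool" (infix "\<cong>\<^sub>T" 50) where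
  "R \<cong>\<^sub>T R' \<longleftrightarrow> R \<preceq>\<^sub>T R' \<and> R' \<preceq>\<^sub>T R"

definition increasing_seqs :: "(nat \<Rightarrow> nat) set" where
  "increasing_seqs = {f. strict_mono f}"

definition D_sys :: "(nat \<Rightarrow> nat, nat \<Rightarrow> nat) relational_system" where
  "D_sys = \<lparr>challenges = increasing_seqs, responses = increasing_seqs,
            met_by = (\<lambda>x y. \<forall>\<^sub>\<infinity>n. x n \<le> y n)\<rparr>"

definition infinite_measure_sets :: "real set set" where
  "infinite_measure_sets = {Y \<in> sets lebesgue. Y \<subseteq> {0..} \<and> emeasure lebesgue Y = \<infinity>}"

text \<open>
  The first argument is the quantifier used for the index \<open>n\<close>; it is meant to be instantiated
  with \<^const>\<open>Alm_all\<close> (all but finitely many) or \<^const>\<open>Inf_many\<close> (infinitely many).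
\<close>

definition R_sys ::
    "((nat \<Rightarrow> bool) \<Rightarrow> bool) \<Rightarrow> nat \<Rightarrow> (nat \<Rightarrow> nat, nat set) relational_system" where
  "R_sys Q k = \<lparr>challenges = increasing_seqs, responses = {X. infinite X},
                met_by = (\<lambda>f X. Q (\<lambda>n. card ({f n..<f (n + 1)} \<inter> X) \<le> k))\<rparr>"

definition M_sys ::
    "((nat \<Rightarrow> bool) \<Rightarrow> bool) \<Rightarrow> real \<Rightarrow> (nat \<Rightarrow> nat, real set) relational_system" where
  "M_sys Q \<epsilon> = \<lparr>challenges = increasing_seqs, responses = infinite_measure_sets,
     met_by = (\<lambda>f Y. Q (\<lambda>n. emeasure lebesgue ({real (f n)..<real (f (n + 1))} \<inter> Y) \<le> ennreal \<epsilon>))\<rparr>"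

lemma min_card_attained:
  assumes "S \<noteq> {}"
  shows "\<exists>A\<in>S. min_card S = |A| \<and> (\<forall>B\<in>S. |A| \<le>o |B| )"
proof -
  obtain r where "r \<in> card_of ` S" "\<forall>r'\<in>card_of ` S. r \<le>o r'"
    using exists_minim_Well_order[of "card_of ` S"] assms card_of_Well_order by blast
  then have "\<exists>A. A \<in> S \<and> (\<forall>B\<in>S. |A| \<le>o |B| )" by auto
  from someI_ex[OF this] show ?thesis unfolding min_card_def by blast
qed

lemma id_increasing: "(\<lambda>n. n) \<in> increasing_seqs"
  by (simp add: increasing_seqs_def strict_mono_def)

lemma is_relational_system_D: "is_relational_system D_sys"
  using id_increasing by (auto simp: is_relational_system_def D_sys_def)

lemma is_relational_system_R: "is_relational_system (R_sys Q k)"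
  using id_increasing infinite_UNIV_nat
  by (auto simp: is_relational_system_def R_sys_def)

lemma D_unbounded_exists: "\<exists>F. R_unbounded D_sys F"
proof -
  have "\<not> (\<forall>\<^sub>\<infinity>n. Suc (y n) \<le> y n)" for y :: "nat \<Rightarrow> nat" by simp
  moreover have "(\<lambda>n. Suc (y n)) \<in> increasing_seqs" if "y \<in> increasing_seqs" for y
    using that by (simp add: increasing_seqs_def strict_mono_def)
  ultimately have "R_unbounded D_sys increasing_seqs"
    unfolding R_unbounded_def R_bounded_def D_sys_def by fastforce
  then show ?thesis by blast
qed

lemma D_dominating_exists: "\<exists>E. R_dominating D_sys E"
proof -
  have "\<exists>y\<in>increasing_seqs. \<forall>\<^sub>\<infinity>n. x n \<le> y n" if "x \<in> increasing_seqs" for x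
    by (rule bexI[OF _ that]) simp
  then have "R_dominating D_sys increasing_seqs"
    by (simp add: R_dominating_def D_sys_def)
  then show ?thesis by blast
qed

lemma large_pieces:
  assumes Y: "Y \<in> infinite_measure_sets"
  shows "\<exists>f\<in>increasing_seqs. \<forall>n. \<not> emeasure lebesgue ({real (f n)..<real (f (n + 1))} \<inter> Y) \<le> ennreal \<epsilon>"
proof -
  have Yl: "Y \<in> sets lebesgue" "Y \<subseteq> {0..}" "emeasure lebesgue Y = \<infinity>"
    using Y by (auto simp: infinite_measure_sets_def)
  have ivl: "emeasure lebesgue {real a..<real b} \<noteq> \<infinity>" for a b
    by (cases "a \<le> b") auto
  have step: "\<exists>j>m. \<not> emeasure lebesgue ({real m..<real j} \<inter> Y) \<le> ennreal \<epsilon>" for m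
  proof (rule ccontr)
    assume "\<not> ?thesis"
    then have le: "emeasure lebesgue ({real m..<real j} \<inter> Y) \<le> ennreal \<epsilon>" for j
      by (cases "j > m") auto
    have "(SUP j. emeasure lebesgue ({real m..<real j} \<inter> Y)) =
        emeasure lebesgue (\<Union>j. {real m..<real j} \<inter> Y)"
      using Yl(1) by (intro SUP_emeasure_incseq) (auto simp: incseq_def)
    also have "(\<Union>j. {real m..<real j} \<inter> Y) = {real m..} \<inter> Y"
      using reals_Archimedean2 by fastforce
    finally have "emeasure lebesgue ({real m..} \<inter> Y) =
        (SUP j. emeasure lebesgue ({real m..<real j} \<inter> Y))" by (rule sym)
    also have "\<dots> \<le> ennreal \<epsilon>" using le by (rule SUP_least)
    finally have tail: "emeasure lebesgue ({real m..} \<inter> Y) \<le> ennreal \<epsilon>" .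
    have "emeasure lebesgue Y \<le> emeasure lebesgue ({real 0..<real m} \<union> ({real m..} \<inter> Y))"
      proof (rule emeasure_mono)
        show "Y \<subseteq> {real 0..<real m} \<union> ({real m..} \<inter> Y)" using Yl(2) by auto
        show "{real 0..<real m} \<union> ({real m..} \<inter> Y) \<in> sets lebesgue"
          by (rule sets.Un[OF _ sets.Int[OF _ Yl(1)]]) simp_all
      qed
    also have "\<dots> \<le> emeasure lebesgue {real 0..<real m} + emeasure lebesgue ({real m..} \<inter> Y)"
      using Yl(1) by (intro emeasure_subadditive) auto
    also have "\<dots> < \<infinity>"
      using tail ivl[of 0 m] by (auto simp: ennreal_add_less_top less_top[symmetric] top_unique)
    finally show False using Yl(3) by simp
  qed
  obtain g where g: "\<And>m. g m > m"
      "\<And>m. \<not> emeasure lebesgue ({real m..<real (g m)} \<inter> Y) \<le> ennreal \<epsilon>"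
    using step by metis
  define f where "f n = (g ^^ n) 0" for n
  have "f \<in> increasing_seqs"
    using g(1) by (simp add: increasing_seqs_def strict_mono_Suc_iff f_def)
  moreover have "\<not> emeasure lebesgue ({real (f n)..<real (f (n + 1))} \<inter> Y) \<le> ennreal \<epsilon>" for n
    using g(2)[of "f n"] by (simp add: f_def)
  ultimately show ?thesis by blast
qed

lemma M_unbounded_exists:
  "\<exists>F. R_unbounded (M_sys Alm_all \<epsilon>) F" "\<exists>F. R_unbounded (M_sys Inf_many \<epsilon>) F"
proof -
  have "R_unbounded (M_sys Q \<epsilon>) increasing_seqs" if Q: "\<not> Q (\<lambda>n. False)" for Q
  proof -
    have "\<exists>f\<in>increasing_seqs. \<not> met_by (M_sys Q \<epsilon>) f Y" if Y: "Y \<in> infinite_measure_sets" for Y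
    proof -
      obtain f where "f \<in> increasing_seqs"
        and f: "\<And>n. \<not> emeasure lebesgue ({real (f n)..<real (f (n + 1))} \<inter> Y) \<le> ennreal \<epsilon>"
        using large_pieces[OF Y] by blast
      moreover have "\<not> met_by (M_sys Q \<epsilon>) f Y"
        using Q by (simp only: M_sys_def relational_system.simps f not_False_eq_True)
      ultimately show ?thesis by blast
    qed
    then show ?thesis
      by (auto simp: R_unbounded_def R_bounded_def) (auto simp: M_sys_def)
  qed
  from this[of Alm_all] this[of Inf_many]
  show "\<exists>F. R_unbounded (M_sys Alm_all \<epsilon>) F" "\<exists>F. R_unbounded (M_sys Inf_many \<epsilon>) F"
    by auto
qed

lemma small_pieces:
  assumes f: "f \<in> increasing_seqs" and \<epsilon>: "\<epsilon> > 0"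
  shows "\<exists>Y\<in>infinite_measure_sets.
           \<forall>n. emeasure lebesgue ({real (f n)..<real (f (n + 1))} \<inter> Y) \<le> ennreal \<epsilon>"
proof -
  define d where "d = min \<epsilon> 1"
  define I where "I n = {real (f n)..<real (f n) + d}" for n
  have d: "0 < d" "d \<le> \<epsilon>" "d \<le> 1" using \<epsilon> by (auto simp: d_def)
  have sep: "real (f m) + 1 \<le> real (f n)" if "m < n" for m n
  proof -
    have "f m < f n" using f that by (simp add: increasing_seqs_def strict_mono_def)
    then show ?thesis by linarith
  qed
  have disj: "I m \<inter> I n = {}" if "m < n" for m n
    using sep[OF that] d by (auto simp: I_def)
  have "disjoint_family I"
    unfolding disjoint_family_on_def by (metis disj Int_commute linorder_neqE_nat)
  then have "emeasure lebesgue (\<Union>n. I n) = (\<Sum>n. emeasure lebesgue (I n))"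
    using suminf_emeasure[of I lebesgue] by (simp add: I_def image_subset_iff)
  also have "\<dots> = (\<Sum>n::nat. ennreal d)" using d by (simp add: I_def)
  also have "\<dots> = \<infinity>"
  proof -
    have "\<not> summable (\<lambda>n::nat. d)" using d(1) by (simp add: summable_const_iff)
    then show ?thesis
      using summable_suminf_not_top[of "\<lambda>n. d"] d(1) by fastforce
  qed
  finally have inf: "emeasure lebesgue (\<Union>n. I n) = \<infinity>" .
  have "(\<Union>n. I n) \<subseteq> {0..}"
  proof
    fix x assume "x \<in> (\<Union>n. I n)"
    then obtain n where "real (f n) \<le> x" by (auto simp: I_def)
    then show "x \<in> {0..}" by (simp add: order_trans[OF of_nat_0_le_iff])
  qed
  moreover have "(\<Union>n. I n) \<in> sets lebesgue"
    by (rule sets.countable_UN) (auto simp: I_def)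
  ultimately have "(\<Union>n. I n) \<in> infinite_measure_sets"
    using inf by (simp only: infinite_measure_sets_def mem_Collect_eq)
  moreover have "emeasure lebesgue ({real (f n)..<real (f (n + 1))} \<inter> (\<Union>n. I n)) \<le> ennreal \<epsilon>" for n
  proof -
    have "x \<in> I n" if x: "real (f n) \<le> x" "x < real (f (n + 1))" "x \<in> I m" for x m
    proof (cases m n rule: linorder_cases)
      case less
      then show ?thesis using sep[OF less] x d by (auto simp: I_def)
    next
      case greater
      then have "f (n + 1) \<le> f m"
        using f by (simp add: increasing_seqs_def strict_mono_less_eq)
      then show ?thesis using x by (auto simp: I_def)
    qed (use x in simp)
    then have "{real (f n)..<real (f (n + 1))} \<inter> (\<Union>n. I n) \<subseteq> I n" by auto
    then have "emeasure lebesgue ({real (f n)..<real (f (n + 1))} \<inter> (\<Union>n. I n))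
        \<le> emeasure lebesgue (I n)"
      by (rule emeasure_mono) (simp add: I_def)
    also have "\<dots> \<le> ennreal \<epsilon>" using d by (simp add: I_def ennreal_leI)
    finally show ?thesis .
  qed
  ultimately show ?thesis by blast
qed

lemma M_dominating_exists:
  assumes "\<epsilon> > 0"
  shows "\<exists>E. R_dominating (M_sys Alm_all \<epsilon>) E" "\<exists>E. R_dominating (M_sys Inf_many \<epsilon>) E"
proof -
  have "R_dominating (M_sys Q \<epsilon>) infinite_measure_sets" if Q: "Q (\<lambda>n. True)" for Q
  proof -
    have "\<exists>Y\<in>infinite_measure_sets. met_by (M_sys Q \<epsilon>) f Y" if f: "f \<in> increasing_seqs" for f
    proof -
      obtain Y where "Y \<in> infinite_measure_sets"
        and Y: "\<And>n. emeasure lebesgue ({real (f n)..<real (f (n + 1))} \<inter> Y) \<le> ennreal \<epsilon>"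
        using small_pieces[OF f assms] by blast
      moreover have "met_by (M_sys Q \<epsilon>) f Y"
        using Q by (simp only: M_sys_def relational_system.simps Y)
      ultimately show ?thesis by blast
    qed
    then show ?thesis by (auto simp: R_dominating_def) (auto simp: M_sys_def)
  qed
  from this[of Alm_all] this[of Inf_many]
  show "\<exists>E. R_dominating (M_sys Alm_all \<epsilon>) E" "\<exists>E. R_dominating (M_sys Inf_many \<epsilon>) E"
    by auto
qed

lemma is_relational_system_M: "is_relational_system (M_sys Q \<epsilon>)"
  using id_increasing small_pieces[OF id_increasing, of 1]
  by (auto simp: is_relational_system_def M_sys_def)

end

theory Submission
  imports Defs
begin

text \<open>
  Both families of systems ask of an interval partition given by \<open>f\<close> that its pieces meet a
  response in a \<^emph>\<open>thin\<close> set (at most \<open>k\<close> points, or measure at most \<open>\<epsilon>\<close>), and only three facts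
  about thinness matter: it passes to subintervals, every response is thick on some interval
  starting at any given point, and for every increasing \<open>g\<close> some response is thin on all
  \<open>[g n, g (n + 2))\<close>. Any such notion of thinness gives a system Tukey equivalent to the dominating
  system \<open>D\<close> when the quantifier is \<open>\<forall>\<^sup>\<infinity>\<close>, and to the dual of \<open>D\<close> when it is \<open>\<exists>\<^sup>\<infinity>\<close>. Tukey
  equivalence is transitive, so the two families are equivalent to each other; and as Tukey
  equivalence preserves the bounding and dominating numbers while duality exchanges them, the four
  cardinal equalities follow.

  The equivalences rest on the following comparison of growth rates. A response \<open>Z\<close> determines the
  function \<open>h\<close> sending \<open>a\<close> to the first \<open>b\<close> for which \<open>Z\<close> is thick on \<open>[a, b)\<close>, and a thin piece
  \<open>[f n, f (n + 1))\<close> forces \<open>f (n + 1) < h (f n)\<close>. If this happens for almost all \<open>n\<close>, then iterates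
  of \<open>h\<close> dominate \<open>f\<close>; if it happens infinitely often and \<open>f\<close> was built by iterating a function
  \<open>x\<close>, then \<open>h\<close> exceeds \<open>x\<close> infinitely often. Conversely, a response that is thin on all
  \<open>[g n, g (n + 2))\<close> is thin on every piece of \<open>f\<close> that lies within one of these intervals. Almost
  all pieces do so if \<open>g\<close> iterates a function dominating \<open>n \<mapsto> f (n + 1)\<close>; and if almost all pieces
  do not, then \<open>f\<close> passes at least two values of \<open>g\<close> in each step and therefore dominates \<open>g\<close>.
\<close>

section \<open>Tukey connections, duality and cardinal characteristics\<close>

lemma tukey_leI:
  assumes "\<And>x. x \<in> challenges R \<Longrightarrow> p x \<in> challenges R'"
    and "\<And>y. y \<in> responses R' \<Longrightarrow> q y \<in> responses R"
    and "\<And>x y. x \<in> challenges R \<Longrightarrow> y \<in> responses R' \<Longrightarrow> met_by R' (p x) y \<Longrightarrow> met_by R x (q y)"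
  shows "R \<preceq>\<^sub>T R'"
  unfolding tukey_le_def using assms by (intro bexI[of _ p] bexI[of _ q]) auto

lemma tukey_leE:
  assumes "R \<preceq>\<^sub>T R'"
  obtains p q where "\<And>x. x \<in> challenges R \<Longrightarrow> p x \<in> challenges R'"
    and "\<And>y. y \<in> responses R' \<Longrightarrow> q y \<in> responses R"
    and "\<And>x y. x \<in> challenges R \<Longrightarrow> y \<in> responses R' \<Longrightarrow> met_by R' (p x) y \<Longrightarrow> met_by R x (q y)"
proof -
  obtain p q where "p \<in> challenges R \<rightarrow> challenges R'" "q \<in> responses R' \<rightarrow> responses R"
    "\<forall>x\<in>challenges R. \<forall>y\<in>responses R'. met_by R' (p x) y \<longrightarrow> met_by R x (q y)"
    using assms unfolding tukey_le_def by blast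
  then show thesis by (intro that[of p q]) auto
qed

lemma tukey_le_trans:
  assumes "R \<preceq>\<^sub>T R'" "R' \<preceq>\<^sub>T R''"
  shows "R \<preceq>\<^sub>T R''"
proof -
  obtain p q where pq: "\<And>x. x \<in> challenges R \<Longrightarrow> p x \<in> challenges R'"
      "\<And>y. y \<in> responses R' \<Longrightarrow> q y \<in> responses R"
      "\<And>x y. x \<in> challenges R \<Longrightarrow> y \<in> responses R' \<Longrightarrow> met_by R' (p x) y \<Longrightarrow> met_by R x (q y)"
    using assms(1) by (rule tukey_leE) blast
  obtain p' q' where pq': "\<And>x. x \<in> challenges R' \<Longrightarrow> p' x \<in> challenges R''"
      "\<And>y. y \<in> responses R'' \<Longrightarrow> q' y \<in> responses R'"
      "\<And>x y. x \<in> challenges R' \<Longrightarrow> y \<in> responses R'' \<Longrightarrow> met_by R'' (p' x) y \<Longrightarrow> met_by R' x (q' y)"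
    using assms(2) by (rule tukey_leE) blast
  show ?thesis
    by (rule tukey_leI[of _ "\<lambda>x. p' (p x)" _ "\<lambda>y. q (q' y)"]) (simp_all add: pq pq')
qed

lemma tukey_equiv_sym: "R \<cong>\<^sub>T R' \<Longrightarrow> R' \<cong>\<^sub>T R"
  by (simp add: tukey_equiv_def)

lemma tukey_equiv_trans: "R \<cong>\<^sub>T R' \<Longrightarrow> R' \<cong>\<^sub>T R'' \<Longrightarrow> R \<cong>\<^sub>T R''"
  unfolding tukey_equiv_def by (blast intro: tukey_le_trans)

lemma min_card_le:
  assumes "T \<noteq> {}" "\<And>B. B \<in> T \<Longrightarrow> \<exists>A\<in>S. |A| \<le>o |B|"
  shows "min_card S \<le>o min_card T"
proof -
  obtain B where B: "B \<in> T" "min_card T = |B|"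
    using min_card_attained[OF assms(1)] by blast
  then obtain A where A: "A \<in> S" "|A| \<le>o |B|" using assms(2) by blast
  then obtain A' where "min_card S = |A'|" "|A'| \<le>o |A|"
    using min_card_attained[of S] by blast
  then show ?thesis using A(2) B(2) ordLeq_transitive by auto
qed

lemma tukey_le_unbounded:
  assumes "R \<preceq>\<^sub>T R'" "R_unbounded R F"
  shows "\<exists>F'. R_unbounded R' F' \<and> |F'| \<le>o |F|"
proof -
  obtain p q where pq: "\<And>x. x \<in> challenges R \<Longrightarrow> p x \<in> challenges R'"
      "\<And>y. y \<in> responses R' \<Longrightarrow> q y \<in> responses R"
      "\<And>x y. x \<in> challenges R \<Longrightarrow> y \<in> responses R' \<Longrightarrow> met_by R' (p x) y \<Longrightarrow> met_by R x (q y)"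
    using assms(1) by (rule tukey_leE) blast
  have F: "F \<subseteq> challenges R" "\<not> (\<exists>y\<in>responses R. \<forall>x\<in>F. met_by R x y)"
    using assms(2) by (auto simp: R_unbounded_def R_bounded_def)
  have "\<not> (\<exists>y\<in>responses R'. \<forall>x\<in>F. met_by R' (p x) y)"
    using F pq(2,3) by (meson subsetD)
  then have "R_unbounded R' (p ` F)"
    using F(1) pq(1) by (auto simp: R_unbounded_def R_bounded_def)
  then show ?thesis using card_of_image by blast
qed

lemma tukey_le_dominating:
  assumes "R \<preceq>\<^sub>T R'" "R_dominating R' E"
  shows "\<exists>E'. R_dominating R E' \<and> |E'| \<le>o |E|"
proof -
  obtain p q where pq: "\<And>x. x \<in> challenges R \<Longrightarrow> p x \<in> challenges R'"
      "\<And>y. y \<in> responses R' \<Longrightarrow> q y \<in> responses R"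
      "\<And>x y. x \<in> challenges R \<Longrightarrow> y \<in> responses R' \<Longrightarrow> met_by R' (p x) y \<Longrightarrow> met_by R x (q y)"
    using assms(1) by (rule tukey_leE) blast
  have E: "E \<subseteq> responses R'" "\<And>x. x \<in> challenges R' \<Longrightarrow> \<exists>y\<in>E. met_by R' x y"
    using assms(2) by (auto simp: R_dominating_def)
  have "R_dominating R (q ` E)"
    unfolding R_dominating_def
  proof (intro conjI ballI)
    show "q ` E \<subseteq> responses R" using E(1) pq(2) by auto
    fix x assume "x \<in> challenges R"
    then show "\<exists>y\<in>q ` E. met_by R x y" using E pq(1,3) by (meson image_eqI subsetD)
  qed
  then show ?thesis using card_of_image by blast
qed

lemma tukey_equiv_bounding_number:
  assumes "R \<cong>\<^sub>T R'" "\<exists>F. R_unbounded R' F"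
  shows "bounding_number R =o bounding_number R'"
proof -
  have le: "R \<preceq>\<^sub>T R'" "R' \<preceq>\<^sub>T R" using assms(1) by (auto simp: tukey_equiv_def)
  have "\<exists>F. R_unbounded R F" using assms(2) tukey_le_unbounded[OF le(2)] by blast
  then have "bounding_number R' \<le>o bounding_number R"
    unfolding bounding_number_def using tukey_le_unbounded[OF le(1)] by (intro min_card_le) auto
  moreover have "bounding_number R \<le>o bounding_number R'"
    unfolding bounding_number_def using assms(2) tukey_le_unbounded[OF le(2)]
    by (intro min_card_le) auto
  ultimately show ?thesis by (simp add: ordIso_iff_ordLeq)
qed

lemma tukey_equiv_dominating_number:
  assumes "R \<cong>\<^sub>T R'" "\<exists>E. R_dominating R' E"
  shows "dominating_number R =o dominating_number R'"
proof -
  have le: "R \<preceq>\<^sub>T R'" "R' \<preceq>\<^sub>T R" using assms(1) by (auto simp: tukey_equiv_def)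
  have "\<exists>E. R_dominating R E" using assms(2) tukey_le_dominating[OF le(1)] by blast
  then have "dominating_number R' \<le>o dominating_number R"
    unfolding dominating_number_def using tukey_le_dominating[OF le(2)]
    by (intro min_card_le) auto
  moreover have "dominating_number R \<le>o dominating_number R'"
    unfolding dominating_number_def using assms(2) tukey_le_dominating[OF le(1)]
    by (intro min_card_le) auto
  ultimately show ?thesis by (simp add: ordIso_iff_ordLeq)
qed

definition dual :: "('a, 'b) relational_system \<Rightarrow> ('b, 'a) relational_system" where
  "dual R = \<lparr>challenges = responses R, responses = challenges R,
             met_by = (\<lambda>y x. \<not> met_by R x y)\<rparr>"

lemma R_unbounded_dual: "R_unbounded (dual R) = R_dominating R"
  by (auto simp: fun_eq_iff dual_def R_unbounded_def R_bounded_def R_dominating_def)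

lemma R_dominating_dual: "R_dominating (dual R) = R_unbounded R"
  by (auto simp: fun_eq_iff dual_def R_unbounded_def R_bounded_def R_dominating_def)

lemma bounding_number_dual: "bounding_number (dual R) = dominating_number R"
  by (simp add: bounding_number_def dominating_number_def R_unbounded_dual)

lemma dominating_number_dual: "dominating_number (dual R) = bounding_number R"
  by (simp add: bounding_number_def dominating_number_def R_dominating_dual)

section \<open>Systems given by a notion of thinness on intervals\<close>

lemma strict_mono_ex_bracket:
  fixes g :: "nat \<Rightarrow> nat"
  assumes "strict_mono g" "g 0 \<le> a"
  shows "\<exists>m. g m \<le> a \<and> a < g (Suc m)"
proof -
  define p where "p = (LEAST p. a < g p)"
  have "a < g (Suc a)" using strict_mono_imp_increasing[OF assms(1), of "Suc a"] by simp
  then have p: "a < g p" unfolding p_def by (rule LeastI)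
  then obtain m where m: "p = Suc m" using assms(2) by (cases p) auto
  then have "\<not> a < g m" using not_less_Least[of m "\<lambda>p. a < g p"] by (simp add: p_def)
  then show ?thesis using p m by (intro exI[of _ m]) auto
qed

text \<open>
  In \<open>ex_thin\<close> the intervals span two steps of \<open>g\<close>, because a piece of another interval partition
  with a value of \<open>g\<close> in its interior overlaps two consecutive pieces of \<open>g\<close>.
\<close>

locale thinness =
  fixes S :: "'z set" and thin :: "nat \<Rightarrow> nat \<Rightarrow> 'z \<Rightarrow> bool"
  assumes thin_subinterval: "Z \<in> S \<Longrightarrow> thin a b Z \<Longrightarrow> a \<le> a' \<Longrightarrow> b' \<le> b \<Longrightarrow> thin a' b' Z"
    and ex_thick: "Z \<in> S \<Longrightarrow> \<exists>b>a. \<not> thin a b Z"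
    and ex_thin: "strict_mono g \<Longrightarrow> \<exists>Z\<in>S. \<forall>n::nat. thin (g n) (g (n + 2)) Z"
begin

definition sys :: "((nat \<Rightarrow> bool) \<Rightarrow> bool) \<Rightarrow> (nat \<Rightarrow> nat, 'z) relational_system" where
  "sys Q = \<lparr>challenges = increasing_seqs, responses = S,
            met_by = (\<lambda>f Z. Q (\<lambda>n. thin (f n) (f (n + 1)) Z))\<rparr>"

definition first_thick :: "'z \<Rightarrow> nat \<Rightarrow> nat" where
  "first_thick Z a = (LEAST b. a < b \<and> \<not> thin a b Z)"

lemma first_thick:
  assumes "Z \<in> S"
  shows "a < first_thick Z a" "\<not> thin a (first_thick Z a) Z"
  using LeastI_ex[OF ex_thick[OF assms, of a, unfolded Bex_def]] unfolding first_thick_def by auto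

lemma thin_less_first_thick:
  assumes "Z \<in> S" "thin a b Z"
  shows "b < first_thick Z a"
  using first_thick(2)[OF assms(1), of a] thin_subinterval[OF assms, of a "first_thick Z a"]
  by (meson le_refl not_le)

lemma mono_first_thick:
  assumes "Z \<in> S"
  shows "mono (first_thick Z)"
proof (rule monoI)
  fix a b :: nat assume "a \<le> b"
  then show "first_thick Z a \<le> first_thick Z b"
    using first_thick[OF assms, of b] thin_subinterval[OF assms, of a "first_thick Z b" b "first_thick Z b"]
    unfolding first_thick_def[of Z a] by (intro Least_le) auto
qed

text \<open>
  If \<open>x (n + 1) < h (x n)\<close> for all \<open>n \<ge> N\<close>, where \<open>h\<close> is \<open>first_thick Z\<close>, then
  \<open>x n \<le> (h ^^ (n - N)) (x N)\<close>. The starting value is absorbed by further iterations,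
  \<open>x N \<le> (h ^^ x N) 0\<close>, so that \<open>n - N + x N\<close> iterations from \<open>0\<close> suffice; eventually this number
  is at most \<open>2 * n\<close>, which no longer depends on \<open>x\<close>.
\<close>

lemma D_tukey_le_sys: "D_sys \<preceq>\<^sub>T sys Alm_all"
proof (rule tukey_leI)
  let ?y = "\<lambda>Z n. (first_thick Z ^^ (2 * n)) 0"
  show "x \<in> challenges D_sys \<Longrightarrow> x \<in> challenges (sys Alm_all)" for x
    by (simp add: D_sys_def sys_def)
  show "?y Z \<in> responses D_sys" if "Z \<in> responses (sys Alm_all)" for Z
  proof -
    have Z: "Z \<in> S" using that by (simp add: sys_def)
    have "a < first_thick Z (first_thick Z a)" for a
      using first_thick(1)[OF Z, of a] first_thick(1)[OF Z, of "first_thick Z a"] by simp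
    then show ?thesis by (simp add: D_sys_def increasing_seqs_def strict_mono_Suc_iff)
  qed
  fix x Z assume x: "x \<in> challenges D_sys" and "Z \<in> responses (sys Alm_all)"
    and "met_by (sys Alm_all) x Z"
  then have Z: "Z \<in> S" and "\<forall>\<^sub>\<infinity>n. thin (x n) (x (n + 1)) Z" by (simp_all add: sys_def)
  then obtain N where N: "\<And>n. n \<ge> N \<Longrightarrow> thin (x n) (x (n + 1)) Z"
    by (auto simp: MOST_nat_le)
  define h where "h = first_thick Z"
  have h: "mono h" "\<And>a. a < h a"
    using mono_first_thick[OF Z] first_thick(1)[OF Z] by (auto simp: h_def)
  have iter: "strict_mono (\<lambda>n. (h ^^ n) 0)" using h(2) by (simp add: strict_mono_Suc_iff)
  have bound: "x (N + i) \<le> (h ^^ (i + x N)) 0" for i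
  proof (induction i)
    case 0
    show ?case using strict_mono_imp_increasing[OF iter, of "x N"] by simp
  next
    case (Suc i)
    have "x (N + Suc i) \<le> h (x (N + i))"
      using thin_less_first_thick[OF Z N[of "N + i"]] by (simp add: h_def)
    also have "\<dots> \<le> h ((h ^^ (i + x N)) 0)" using Suc.IH h(1) by (rule monoD[rotated])
    finally show ?case by simp
  qed
  have "x n \<le> (h ^^ (2 * n)) 0" if "n \<ge> N + x N" for n
  proof -
    have "x n \<le> (h ^^ (n - N + x N)) 0" using bound[of "n - N"] that by simp
    also have "\<dots> \<le> (h ^^ (2 * n)) 0"
      using that strict_mono_less_eq[OF iter, of "n - N + x N" "2 * n"] by simp
    finally show ?thesis .
  qed
  then show "met_by D_sys x (?y Z)" by (auto simp: D_sys_def h_def MOST_nat_le)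
qed

text \<open>
  Let \<open>g\<close> iterate a function \<open>y\<close> that dominates \<open>m \<mapsto> f (m + 1)\<close>. If \<open>f n\<close> lies in
  \<open>[g m, g (m + 1))\<close>, then \<open>g (m + 2)\<close> exceeds \<open>y (g (m + 1))\<close>, hence also \<open>f (n + 1)\<close>, since
  \<open>n \<le> f n < g (m + 1)\<close>; so the piece of \<open>f\<close> is contained in \<open>[g m, g (m + 2))\<close>.
\<close>

lemma sys_tukey_le_D: "sys Alm_all \<preceq>\<^sub>T D_sys"
proof -
  define g where "g y n = ((\<lambda>a. Suc (y a)) ^^ n) 0" for y :: "nat \<Rightarrow> nat" and n :: nat
  have g: "strict_mono (g y)" if "y \<in> increasing_seqs" for y
    using that strict_mono_imp_increasing[of y]
    by (simp add: g_def strict_mono_Suc_iff increasing_seqs_def less_Suc_eq_le)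
  obtain Z where Z: "\<And>y. y \<in> increasing_seqs \<Longrightarrow> Z y \<in> S"
      "\<And>y n. y \<in> increasing_seqs \<Longrightarrow> thin (g y n) (g y (n + 2)) (Z y)"
    using ex_thin[OF g] by metis
  show ?thesis
  proof (rule tukey_leI)
    show "(\<lambda>m. f (m + 1)) \<in> challenges D_sys" if "f \<in> challenges (sys Alm_all)" for f
      using that by (simp add: D_sys_def sys_def increasing_seqs_def strict_mono_def)
    show "Z y \<in> responses (sys Alm_all)" if "y \<in> responses D_sys" for y
      using that Z(1) by (simp add: D_sys_def sys_def)
    fix f y assume "f \<in> challenges (sys Alm_all)" and "y \<in> responses D_sys"
      and "met_by D_sys (\<lambda>m. f (m + 1)) y"
    then have f: "strict_mono f" and y: "y \<in> increasing_seqs" and "\<forall>\<^sub>\<infinity>m. f (m + 1) \<le> y m"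
      by (simp_all add: D_sys_def sys_def increasing_seqs_def)
    then obtain N where N: "\<And>m. m \<ge> N \<Longrightarrow> f (m + 1) \<le> y m" by (auto simp: MOST_nat_le)
    have "thin (f n) (f (n + 1)) (Z y)" if n: "n \<ge> N" for n
    proof -
      obtain m where m: "g y m \<le> f n" "f n < g y (Suc m)"
        using strict_mono_ex_bracket[OF g[OF y], of "f n"] by (auto simp: g_def)
      have le: "n \<le> g y (Suc m)" using strict_mono_imp_increasing[OF f, of n] m(2) by simp
      have "f (n + 1) \<le> f (g y (Suc m) + 1)" using le by (simp add: strict_mono_less_eq[OF f])
      also have "\<dots> \<le> y (g y (Suc m))" using N le n by simp
      also have "\<dots> \<le> g y (m + 2)" by (simp add: g_def)
      finally show ?thesis using thin_subinterval[OF Z(1)[OF y] Z(2)[OF y, of m] m(1)] by blast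
    qed
    then show "met_by (sys Alm_all) f (Z y)" by (auto simp: sys_def MOST_nat_le)
  qed
qed

text \<open>
  Let \<open>f\<close> iterate \<open>x\<close>. A thin piece of \<open>f\<close> starting at \<open>a = f n\<close> ends after \<open>x a\<close> but before
  \<open>first_thick Z a\<close>, so infinitely many thin pieces give infinitely many \<open>a\<close> at which
  \<open>first_thick Z\<close> exceeds \<open>x\<close>.
\<close>

lemma dual_D_tukey_le_sys: "dual D_sys \<preceq>\<^sub>T sys Inf_many"
proof (rule tukey_leI)
  let ?f = "\<lambda>x n. ((\<lambda>a. Suc (x a)) ^^ n) 0"
  \<comment> \<open>Adding \<open>a\<close> turns the monotone \<open>first_thick Z\<close> into a strictly increasing function.\<close>
  let ?y = "\<lambda>Z a. first_thick Z a + a"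
  have f: "strict_mono (?f x)" if "x \<in> increasing_seqs" for x
    using that strict_mono_imp_increasing[of x]
    by (simp add: strict_mono_Suc_iff increasing_seqs_def less_Suc_eq_le)
  show "?f x \<in> challenges (sys Inf_many)" if "x \<in> challenges (dual D_sys)" for x
    using that f by (simp add: D_sys_def dual_def sys_def increasing_seqs_def)
  show "?y Z \<in> responses (dual D_sys)" if "Z \<in> responses (sys Inf_many)" for Z
    using that mono_first_thick[of Z]
    by (auto simp: D_sys_def dual_def sys_def increasing_seqs_def strict_mono_def mono_def
             intro!: add_le_less_mono)
  fix x Z assume "x \<in> challenges (dual D_sys)" and "Z \<in> responses (sys Inf_many)"
    and "met_by (sys Inf_many) (?f x) Z"
  then have fx: "strict_mono (?f x)" and Z: "Z \<in> S"
    and inf: "\<exists>\<^sub>\<infinity>n. thin (?f x n) (?f x (n + 1)) Z"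
    using f by (simp_all add: D_sys_def dual_def sys_def)
  have "\<not> (\<forall>\<^sub>\<infinity>a. ?y Z a \<le> x a)"
  proof
    assume "\<forall>\<^sub>\<infinity>a. ?y Z a \<le> x a"
    then obtain N where N: "\<And>a. a \<ge> N \<Longrightarrow> ?y Z a \<le> x a" by (auto simp: MOST_nat_le)
    obtain n where n: "n \<ge> N" "thin (?f x n) (?f x (n + 1)) Z"
      using inf by (auto simp: INFM_nat_le)
    have "x (?f x n) < ?f x (n + 1)" by simp
    also have "\<dots> < first_thick Z (?f x n)" by (rule thin_less_first_thick[OF Z n(2)])
    finally have "x (?f x n) < first_thick Z (?f x n)" .
    moreover have "N \<le> ?f x n" using strict_mono_imp_increasing[OF fx, of n] n(1) by simp
    ultimately show False using N[of "?f x n"] by simp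
  qed
  then show "met_by (dual D_sys) x (?y Z)" by (simp add: D_sys_def dual_def)
qed

text \<open>
  Suppose that from \<open>f N \<ge> y 0\<close> on, no piece of \<open>f\<close> is thin for a response that is thin on all
  \<open>[y n, y (n + 2))\<close>. Then \<open>f\<close> passes two values of \<open>y\<close> in each step, so
  \<open>y (2 * i) \<le> f (N + i)\<close>, and \<open>y n \<le> f n\<close> as soon as \<open>n \<le> 2 * (n - N)\<close>.
\<close>

lemma sys_tukey_le_dual_D: "sys Inf_many \<preceq>\<^sub>T dual D_sys"
proof -
  obtain Z where Z: "\<And>y. y \<in> increasing_seqs \<Longrightarrow> Z y \<in> S"
      "\<And>y n. y \<in> increasing_seqs \<Longrightarrow> thin (y n) (y (n + 2)) (Z y)"
    using ex_thin unfolding increasing_seqs_def mem_Collect_eq by metis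
  show ?thesis
  proof (rule tukey_leI)
    show "f \<in> challenges (dual D_sys)" if "f \<in> challenges (sys Inf_many)" for f
      using that by (simp add: D_sys_def dual_def sys_def)
    show "Z y \<in> responses (sys Inf_many)" if "y \<in> responses (dual D_sys)" for y
      using that Z(1) by (simp add: D_sys_def dual_def sys_def)
    fix f y assume "f \<in> challenges (sys Inf_many)" and "y \<in> responses (dual D_sys)"
      and "met_by (dual D_sys) f y"
    then have f: "strict_mono f" and y: "y \<in> increasing_seqs" and nle: "\<not> (\<forall>\<^sub>\<infinity>n. y n \<le> f n)"
      by (simp_all add: D_sys_def dual_def sys_def increasing_seqs_def)
    have "\<exists>\<^sub>\<infinity>n. thin (f n) (f (n + 1)) (Z y)"
    proof (rule ccontr)
      assume "\<not> ?thesis"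
      then obtain N0 where N0: "\<And>n. n \<ge> N0 \<Longrightarrow> \<not> thin (f n) (f (n + 1)) (Z y)"
        by (auto simp: INFM_nat_le)
      define N where "N = max N0 (y 0)"
      have pass: "y (2 * i) \<le> f (N + i)" for i
      proof (induction i)
        case 0
        show ?case using strict_mono_imp_increasing[OF f, of N] by (simp add: N_def)
      next
        case (Suc i)
        have "\<not> thin (f (N + i)) (f (N + i + 1)) (Z y)" using N0 by (simp add: N_def)
        then have "\<not> f (N + i + 1) \<le> y (2 * i + 2)"
          using thin_subinterval[OF Z(1)[OF y] Z(2)[OF y] Suc.IH] by blast
        then show ?case by simp
      qed
      have "y n \<le> f n" if "n \<ge> 2 * N" for n
      proof -
        have "y n \<le> y (2 * (n - N))"
          using that y by (simp add: increasing_seqs_def strict_mono_less_eq)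
        also have "\<dots> \<le> f n" using pass[of "n - N"] that by simp
        finally show ?thesis .
      qed
      then show False using nle by (auto simp: MOST_nat_le)
    qed
    then show "met_by (sys Inf_many) f (Z y)" by (simp add: sys_def)
  qed
qed

lemma sys_Alm_all_equiv: "sys Alm_all \<cong>\<^sub>T D_sys"
  and sys_Inf_many_equiv: "sys Inf_many \<cong>\<^sub>T dual D_sys"
  by (simp_all add: tukey_equiv_def D_tukey_le_sys sys_tukey_le_D dual_D_tukey_le_sys
      sys_tukey_le_dual_D)

end

section \<open>Thinness in cardinality and in measure\<close>

text \<open>
  For \<open>ex_thin\<close>, the set of every second value of \<open>g\<close> has exactly one point in each
  \<open>[g n, g (n + 2))\<close>.
\<close>

lemma thinness_card:
  assumes "k > 0"
  shows "thinness {X. infinite X} (\<lambda>a b X. card ({a..<b} \<inter> X) \<le> k)"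
proof
  fix a b a' b' :: nat and X
  assume thin: "card ({a..<b} \<inter> X) \<le> k" and "a \<le> a'" "b' \<le> b"
  then have "card ({a'..<b'} \<inter> X) \<le> card ({a..<b} \<inter> X)" by (intro card_mono) auto
  then show "card ({a'..<b'} \<inter> X) \<le> k" using thin by (rule order_trans)
next
  fix X :: "nat set" and a assume "X \<in> {X. infinite X}"
  then have "infinite (X - {..<a})" by simp
  then obtain T where T: "T \<subseteq> X - {..<a}" "finite T" "card T = Suc k"
    using infinite_arbitrarily_large by blast
  have "T \<subseteq> {a..<a + Suc (Max T)} \<inter> X"
    using T(1) Max_ge[OF T(2)] by (fastforce simp: less_Suc_eq_le intro: trans_le_add2)
  then have "Suc k \<le> card ({a..<a + Suc (Max T)} \<inter> X)"
    using T(3) by (metis card_mono finite_Int finite_atLeastLessThan)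
  then show "\<exists>b>a. \<not> card ({a..<b} \<inter> X) \<le> k" by (intro exI[of _ "a + Suc (Max T)"]) simp
next
  fix g :: "nat \<Rightarrow> nat" assume g: "strict_mono g"
  let ?X = "range (\<lambda>n. g (2 * n))"
  have "inj (\<lambda>n. g (2 * n))" using strict_mono_eq[OF g] by (auto intro: injI)
  then have "infinite ?X" by (simp add: range_inj_infinite)
  moreover have "card ({g n..<g (n + 2)} \<inter> ?X) \<le> k" for n
  proof -
    have "{g n..<g (n + 2)} \<inter> ?X \<subseteq> {g (2 * ((n + 1) div 2))}"
      by (auto simp: strict_mono_less_eq[OF g] strict_mono_less[OF g] intro!: arg_cong[of _ _ g])
    from card_mono[OF _ this] show ?thesis using assms by simp
  qed
  ultimately show "\<exists>X\<in>{X. infinite X}. \<forall>n. card ({g n..<g (n + 2)} \<inter> X) \<le> k" by blast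
qed

text \<open>
  For \<open>ex_thin\<close>, a set of measure at most \<open>\<epsilon> / 2\<close> on each piece of \<open>g\<close> suffices, since
  \<open>[g n, g (n + 2))\<close> consists of two pieces.
\<close>

lemma thinness_emeasure:
  assumes "\<epsilon> > 0"
  shows "thinness infinite_measure_sets
           (\<lambda>a b Y. emeasure lebesgue ({real a..<real b} \<inter> Y) \<le> ennreal \<epsilon>)"
proof
  fix a b a' b' :: nat and Y
  assume Y: "Y \<in> infinite_measure_sets" and le: "a \<le> a'" "b' \<le> b"
    and thin: "emeasure lebesgue ({real a..<real b} \<inter> Y) \<le> ennreal \<epsilon>"
  have "emeasure lebesgue ({real a'..<real b'} \<inter> Y) \<le> emeasure lebesgue ({real a..<real b} \<inter> Y)"
    using Y le by (intro emeasure_mono) (auto simp: infinite_measure_sets_def)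
  then show "emeasure lebesgue ({real a'..<real b'} \<inter> Y) \<le> ennreal \<epsilon>"
    using thin by (rule order_trans)
next
  fix Y a assume Y: "Y \<in> infinite_measure_sets"
  obtain f where "f \<in> increasing_seqs"
    and thick: "\<And>n. \<not> emeasure lebesgue ({real (f n)..<real (f (n + 1))} \<inter> Y) \<le> ennreal \<epsilon>"
    using large_pieces[OF Y] by blast
  then have f: "strict_mono f" by (simp add: increasing_seqs_def)
  have a: "a \<le> f a" "f a < f (a + 1)"
    using strict_mono_imp_increasing[OF f] f by (auto simp: strict_mono_def)
  have "emeasure lebesgue ({real (f a)..<real (f (a + 1))} \<inter> Y)
      \<le> emeasure lebesgue ({real a..<real (f (a + 1))} \<inter> Y)"
    using Y a by (intro emeasure_mono) (auto simp: infinite_measure_sets_def)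
  then show "\<exists>b>a. \<not> emeasure lebesgue ({real a..<real b} \<inter> Y) \<le> ennreal \<epsilon>"
    using thick[of a] a by (intro exI[of _ "f (a + 1)"]) (auto dest: order_trans)
next
  fix g :: "nat \<Rightarrow> nat" assume g: "strict_mono g"
  let ?m = "\<lambda>Y a b. emeasure lebesgue ({real a..<real b} \<inter> Y)"
  obtain Y where Y: "Y \<in> infinite_measure_sets"
    and piece: "\<And>n. ?m Y (g n) (g (n + 1)) \<le> ennreal (\<epsilon> / 2)"
    using small_pieces[of g "\<epsilon> / 2"] g assms by (auto simp: increasing_seqs_def)
  have "?m Y (g n) (g (n + 2)) \<le> ennreal \<epsilon>" for n
  proof -
    have "g n \<le> g (n + 1)" "g (n + 1) \<le> g (n + 2)" by (simp_all add: strict_mono_less_eq[OF g])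
    then have "{real (g n)..<real (g (n + 2))} \<inter> Y =
        ({real (g n)..<real (g (n + 1))} \<inter> Y) \<union> ({real (g (n + 1))..<real (g (n + 2))} \<inter> Y)"
      by auto
    then have "?m Y (g n) (g (n + 2)) \<le> ?m Y (g n) (g (n + 1)) + ?m Y (g (n + 1)) (g (n + 2))"
      using Y by (simp only:) (intro emeasure_subadditive; auto simp: infinite_measure_sets_def)
    also have "\<dots> \<le> ennreal (\<epsilon> / 2) + ennreal (\<epsilon> / 2)"
      using piece[of n] piece[of "n + 1"] by (intro add_mono) (simp_all add: numeral_2_eq_2)
    also have "\<dots> = ennreal \<epsilon>" using assms by (simp flip: ennreal_plus)
    finally show ?thesis .
  qed
  then show "\<exists>Y\<in>infinite_measure_sets. \<forall>n. ?m Y (g n) (g (n + 2)) \<le> ennreal \<epsilon>"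
    using Y by blast
qed

theorem theoremD:
  fixes \<epsilon> :: real and k :: nat
  assumes "\<epsilon> > 0" and "k > 0"
  shows "M_sys Alm_all \<epsilon> \<cong>\<^sub>T R_sys Alm_all k \<and>
         M_sys Inf_many \<epsilon> \<cong>\<^sub>T R_sys Inf_many k \<and>
         bounding_number (M_sys Alm_all \<epsilon>) =o bounding_number D_sys \<and>
         dominating_number (M_sys Alm_all \<epsilon>) =o dominating_number D_sys \<and>
         bounding_number (M_sys Inf_many \<epsilon>) =o dominating_number D_sys \<and>
         dominating_number (M_sys Inf_many \<epsilon>) =o bounding_number D_sys"
proof -
  interpret R: thinness "{X. infinite X}" "\<lambda>a b X. card ({a..<b} \<inter> X) \<le> k"
    using assms(2) by (rule thinness_card)
  interpret M: thinness infinite_measure_sets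
      "\<lambda>a b Y. emeasure lebesgue ({real a..<real b} \<inter> Y) \<le> ennreal \<epsilon>"
    using assms(1) by (rule thinness_emeasure)
  have R_eq: "R_sys Q k = R.sys Q" for Q by (simp add: R_sys_def R.sys_def)
  have M_eq: "M_sys Q \<epsilon> = M.sys Q" for Q by (simp add: M_sys_def M.sys_def)
  have R: "R_sys Alm_all k \<cong>\<^sub>T D_sys" "R_sys Inf_many k \<cong>\<^sub>T dual D_sys"
    unfolding R_eq by (rule R.sys_Alm_all_equiv R.sys_Inf_many_equiv)+
  have M: "M_sys Alm_all \<epsilon> \<cong>\<^sub>T D_sys" "M_sys Inf_many \<epsilon> \<cong>\<^sub>T dual D_sys"
    unfolding M_eq by (rule M.sys_Alm_all_equiv M.sys_Inf_many_equiv)+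
  have "bounding_number (M_sys Alm_all \<epsilon>) =o bounding_number D_sys"
    using M(1) D_unbounded_exists by (rule tukey_equiv_bounding_number)
  moreover have "dominating_number (M_sys Alm_all \<epsilon>) =o dominating_number D_sys"
    using M(1) D_dominating_exists by (rule tukey_equiv_dominating_number)
  moreover have "bounding_number (M_sys Inf_many \<epsilon>) =o dominating_number D_sys"
    using tukey_equiv_bounding_number[OF M(2)] D_dominating_exists
    by (simp add: R_unbounded_dual bounding_number_dual)
  moreover have "dominating_number (M_sys Inf_many \<epsilon>) =o bounding_number D_sys"
    using tukey_equiv_dominating_number[OF M(2)] D_unbounded_exists
    by (simp add: R_dominating_dual dominating_number_dual)
  ultimately show ?thesis
    using tukey_equiv_trans[OF M(1) tukey_equiv_sym[OF R(1)]]
      tukey_equiv_trans[OF M(2) tukey_equiv_sym[OF R(2)]] by blast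
qed

end
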